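(* Let $G$ be a graph and let $C_1,\ldots,C_t$ be all the cycles of $G$, each oriented according to a given cycle orientation configuration. The configuration is geometric if and only if the only solution of $n_1C_1+n_2C_2+\cdots+n_tC_t=0$ (in $C_1(G,\mathbb{R})$) in nonnegative integers $n_1,\ldots,n_t$ is $n_1=\cdots=n_t=0$.
   Context: Graphs are finite and connected, possibly with parallel edges but without loops; cycles are simple. Each edge has a fixed reference orientation; an oriented cycle $C$ is identified with $\sum_{e\in C}\operatorname{sign}(C,e)e$ in the real vector space $C_1(G,\mathbb{R})$ with orthonormal basis $E(G)$, where $\operatorname{sign}(C,e)=\pm1$ according as $C$ traverses $e$ along or against its reference orientation. $H_1(G,\mathbb{R})$ is the span of all cycles. A cycle orientation configuration assigns an orientation to each cycle of $G$; it is geometric if there exists $\mathbf{w}\in H_1(G,\mathbb{R})$ with $\langle\mathbf{w},C\rangle>0$ for every cycle $C$ oriented as in the configuration. *)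

theory Defs
  imports "HOL-Analysis.Analysis" "Graph_Theory.Graph_Theory"
begin

text \<open>
  A multigraph with a fixed reference orientation of its edges is a \<^typ>\<open>('v, 'e) pre_digraph\<close>:
  every arc is an edge, directed from its tail to its head by the reference orientation, and
  parallel arcs are allowed. A dart is an edge with a direction of traversal: \<open>(e, True)\<close>
  runs along the reference orientation of \<open>e\<close> and \<open>(e, False)\<close> against it. Walks in the
  underlying undirected multigraph are the arc walks of the digraph of darts.
\<close>

definition dart_digraph :: "('v, 'e) pre_digraph \<Rightarrow> ('v, 'e \<times> bool) pre_digraph" where
  "dart_digraph G =
    \<lparr> verts = verts G,
      arcs = arcs G \<times> UNIV,
      tail = (\<lambda>(e, b). if b then tail G e else head G e),
      head = (\<lambda>(e, b). if b then head G e else tail G e) \<rparr>"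

text \<open>
  An oriented simple cycle is represented by its set of darts, so that the choice of a starting
  vertex is forgotten. \<^const>\<open>pre_digraph.cycle\<close> excludes repeated vertices but admits the
  closed walk that traverses one edge back and forth; the distinctness of the edges
  excludes that walk and still allows cycles formed by two parallel edges.
\<close>

definition oriented_cycle :: "('v, 'e) pre_digraph \<Rightarrow> ('e \<times> bool) set \<Rightarrow> bool" where
  "oriented_cycle G D \<longleftrightarrow>
    (\<exists>p. pre_digraph.cycle (dart_digraph G) p \<and> distinct (map fst p) \<and> D = set p)"

text \<open>Unoriented cycles are represented by their edge sets.\<close>

definition cycles :: "('v, 'e) pre_digraph \<Rightarrow> 'e set set" where
  "cycles G = {fst ` D | D. oriented_cycle G D}"

definition cycle_sign :: "('e \<times> bool) set \<Rightarrow> 'e \<Rightarrow> real" where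
  "cycle_sign D e = (if (e, True) \<in> D then 1 else - 1)"

text \<open>
  The chain space \<open>C\<^sub>1(G, \<real>)\<close> is the subspace of \<^typ>\<open>real ^ 'e\<close> spanned by the orthonormal
  vectors \<open>axis e 1\<close> for the edges \<open>e\<close> of \<open>G\<close>. The edge set may be a proper subset of
  the type \<open>'e\<close>; in particular it may be empty.
\<close>

definition cycle_vec :: "('e::finite \<times> bool) set \<Rightarrow> real ^ 'e" where
  "cycle_vec D = (\<Sum>e\<in>fst ` D. cycle_sign D e *\<^sub>R axis e 1)"

definition H1 :: "('v, 'e::finite) pre_digraph \<Rightarrow> (real ^ 'e) set" where
  "H1 G = span {cycle_vec D | D. oriented_cycle G D}"

definition cycle_orientation_configuration ::
    "('v, 'e) pre_digraph \<Rightarrow> ('e set \<Rightarrow> ('e \<times> bool) set) \<Rightarrow> bool" where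
  "cycle_orientation_configuration G \<sigma> \<longleftrightarrow>
    (\<forall>C\<in>cycles G. oriented_cycle G (\<sigma> C) \<and> fst ` \<sigma> C = C)"

definition geometric ::
    "('v, 'e::finite) pre_digraph \<Rightarrow> ('e set \<Rightarrow> ('e \<times> bool) set) \<Rightarrow> bool" where
  "geometric G \<sigma> \<longleftrightarrow> (\<exists>w\<in>H1 G. \<forall>C\<in>cycles G. w \<bullet> cycle_vec (\<sigma> C) > 0)"

end

theory Submission
  imports Defs
begin

text \<open>
  A vector that pairs positively with all cycles excludes nontrivial nonnegative relations.
  Conversely, without such relations the nontrivial nonnegative integer combinations of the cycles
  form an additive semigroup that avoids 0. Fourier--Motzkin elimination of the coordinates never
  leaves this semigroup, because the cycles have integer coordinates, and so it produces
  a vector pairing positively with all cycles, which is then projected orthogonally to \<open>H\<^sub>1\<close>.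
\<close>

text \<open>Scaling by a positive integer is repeated addition. The scalar is a real number in
  \<open>\<int>\<close> because in the elimination it is, up to sign, a coordinate of a
  vector.\<close>

lemma semigroup_scaleR_Ints:
  fixes x :: "'a::real_vector"
  assumes add: "\<And>x y. x \<in> M \<Longrightarrow> y \<in> M \<Longrightarrow> x + y \<in> M"
    and "x \<in> M" "c \<in> \<int>" "c > 0"
  shows "c *\<^sub>R x \<in> M"
proof -
  \<comment> \<open>The induction starts at the multiple 1: the multiple 0 would be the zero vector,
    which \<open>M\<close> need not contain.\<close>
  have "real (Suc n) *\<^sub>R x \<in> M" for n
  proof (induction n)
    case (Suc n)
    have "real (Suc (Suc n)) *\<^sub>R x = x + real (Suc n) *\<^sub>R x"
      by (simp only: of_nat_Suc[of "Suc n"] scaleR_add_left scaleR_one)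
    with add[OF \<open>x \<in> M\<close> Suc.IH] show ?case by simp
  qed (simp add: \<open>x \<in> M\<close>)
  moreover obtain n where "c = real (Suc n)"
  proof -
    from \<open>c \<in> \<int>\<close> obtain i where "c = of_int i" by (elim Ints_cases)
    with \<open>c > 0\<close> have "c = real (Suc (nat i - 1))" by simp
    then show thesis by (rule that)
  qed
  ultimately show ?thesis by blast
qed

text \<open>Serves to choose the coefficient of the eliminated coordinate strictly between its lower
  and upper bounds. Either set of bounds may be empty, hence the case distinctions.\<close>

lemma finite_real_separation:
  fixes A B :: "real set"
  assumes "finite A" "finite B" "\<And>a b. a \<in> A \<Longrightarrow> b \<in> B \<Longrightarrow> a < b"
  shows "\<exists>t. (\<forall>a\<in>A. a < t) \<and> (\<forall>b\<in>B. t < b)"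
proof (cases "A = {}")
  case True
  \<comment> \<open>Inserting 0 keeps the minimum meaningful when \<open>B\<close> is empty.\<close>
  have "Min (insert 0 B) - 1 < b" if "b \<in> B" for b
  proof -
    have "Min (insert 0 B) \<le> b" using that \<open>finite B\<close> by (intro Min_le) auto
    then show ?thesis by linarith
  qed
  with True show ?thesis by blast
next
  case False
  have "\<exists>t>Max A. \<forall>b\<in>B. t < b"
  proof (cases "B = {}")
    case False
    then have "Max A < Min B" using assms \<open>A \<noteq> {}\<close> by simp
    from dense[OF this] show ?thesis using False \<open>finite B\<close> by auto
  qed (simp add: gt_ex)
  then obtain t where "Max A < t" "\<forall>b\<in>B. t < b" by blast
  then show ?thesis using \<open>finite A\<close> False by auto
qed

text \<open>Fourier-Motzkin elimination, by induction on the set \<open>K\<close> of coordinates not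
  yet known to vanish on \<open>V\<close>. The semigroup \<open>M\<close> stays fixed while
  \<open>V\<close> changes, so that \<open>0 \<notin> M\<close> is still available when no
  coordinate is left.\<close>

lemma semigroup_integer_vectors_separation:
  fixes V M :: "'a::euclidean_space set"
  assumes add: "\<And>x y. x \<in> M \<Longrightarrow> y \<in> M \<Longrightarrow> x + y \<in> M" and "0 \<notin> M"
    and "finite K" "K \<subseteq> Basis"
    and "finite V" "V \<subseteq> M"
    and "\<And>v b. v \<in> V \<Longrightarrow> b \<in> Basis \<Longrightarrow> v \<bullet> b \<in> \<int>"
    and "\<And>v b. v \<in> V \<Longrightarrow> b \<in> Basis - K \<Longrightarrow> v \<bullet> b = 0"
  shows "\<exists>w. \<forall>v\<in>V. w \<bullet> v > 0"
  using assms(3-)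
proof (induction K arbitrary: V rule: finite_induct)
  case empty
  \<comment> \<open>With all coordinates vanishing, \<open>V\<close> could contain only 0, which
    \<open>M\<close> excludes. So \<open>V\<close> is empty and any \<open>w\<close> will
    do.\<close>
  have "v = 0" if "v \<in> V" for v
    by (rule euclidean_eqI) (use empty.prems that in auto)
  with \<open>0 \<notin> M\<close> empty.prems show ?case by blast
next
  case (insert k K)
  let ?P = "{v \<in> V. v \<bullet> k > 0}" and ?N = "{v \<in> V. v \<bullet> k < 0}"
  \<comment> \<open>The \<open>k\<close>-coordinates of \<open>p\<close> and \<open>q\<close> have
    opposite signs. This combination cancels them, and its coefficients are positive integers, so it
    stays in \<open>M\<close>.\<close>
  let ?elim = "\<lambda>(p, q). (p \<bullet> k) *\<^sub>R q + (- (q \<bullet> k)) *\<^sub>R p"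
  let ?V = "{v \<in> V. v \<bullet> k = 0} \<union> ?elim ` (?P \<times> ?N)"
  have k: "k \<in> Basis" using insert.prems by simp
  have "\<exists>w. \<forall>v\<in>?V. w \<bullet> v > 0"
  proof (rule insert.IH)
    show "K \<subseteq> Basis" "finite ?V" using insert.prems by auto
    have "?elim (p, q) \<in> M" if "p \<in> ?P" "q \<in> ?N" for p q
    proof -
      have "p \<in> M" "q \<in> M" "p \<bullet> k \<in> \<int>" "- (q \<bullet> k) \<in> \<int>"
        using that insert.prems(3) insert.prems(4) k by auto
      then have "(p \<bullet> k) *\<^sub>R q \<in> M" "(- (q \<bullet> k)) *\<^sub>R p \<in> M"
        using that by (simp_all only: semigroup_scaleR_Ints[OF add] mem_Collect_eq neg_0_less_iff_less)
      from add[OF this] show ?thesis by simp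
    qed
    then show "?V \<subseteq> M" using insert.prems(3) by blast
    show "v \<bullet> b \<in> \<int>" if "v \<in> ?V" "b \<in> Basis" for v b
      using that insert.prems(4) k
      by (auto simp: inner_add_left inner_diff_left intro!: Ints_add Ints_diff Ints_mult)
    show "v \<bullet> b = 0" if "v \<in> ?V" "b \<in> Basis - K" for v b
      using that insert.prems(5) by (cases "b = k") (auto simp: inner_diff_left)
  qed
  then obtain w where w: "\<forall>v\<in>?V. w \<bullet> v > 0" ..
  \<comment> \<open>The value of \<open>t\<close> at which \<open>w + t *\<^sub>R k\<close> is
    orthogonal to \<open>v\<close>: a lower bound for \<open>t\<close> if
    \<open>v \<bullet> k > 0\<close>, an upper bound if \<open>v \<bullet> k < 0\<close>.\<close>
  let ?bound = "\<lambda>v. - (w \<bullet> v) / (v \<bullet> k)"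
  have "\<exists>t. (\<forall>a\<in>?bound ` ?P. a < t) \<and> (\<forall>b\<in>?bound ` ?N. t < b)"
  proof (rule finite_real_separation)
    fix a b assume "a \<in> ?bound ` ?P" "b \<in> ?bound ` ?N"
    then obtain p q where pq: "p \<in> ?P" "a = ?bound p" "q \<in> ?N" "b = ?bound q" by blast
    then have "?elim (p, q) \<in> ?V" by blast
    with w have "w \<bullet> ?elim (p, q) > 0" by blast
    \<comment> \<open>Division by the positive number
      \<open>- (p \<bullet> k) * (q \<bullet> k)\<close> turns this into the required comparison of
      the two bounds.\<close>
    then have "(p \<bullet> k) * (w \<bullet> q) - (q \<bullet> k) * (w \<bullet> p) > 0" by (simp add: inner_diff_right)
    then have "?bound p < ?bound q" using pq(1,3) by (simp add: field_simps)
    then show "a < b" using pq(2,4) by simp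
  qed (use insert.prems in auto)
  then obtain t where lower: "\<And>p. p \<in> ?P \<Longrightarrow> ?bound p < t" and upper: "\<And>q. q \<in> ?N \<Longrightarrow> t < ?bound q"
    by blast
  have "(w + t *\<^sub>R k) \<bullet> v > 0" if v: "v \<in> V" for v
  proof -
    consider "v \<bullet> k = 0" | "v \<bullet> k > 0" | "v \<bullet> k < 0" by linarith
    then have "w \<bullet> v + t * (v \<bullet> k) > 0"
    proof cases
      case 1 then show ?thesis using w v by auto
    next
      case 2 then show ?thesis using lower[of v] v by (simp add: field_simps)
    next
      case 3 then show ?thesis using upper[of v] v by (simp add: field_simps)
    qed
    then show ?thesis by (simp add: inner_add_left inner_commute[of k v])
  qed
  then show ?case by blast
qed

text \<open>An integral form of Gordan's theorem. The family is indexed, so that the coefficients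
  belong to indices even if some vectors coincide.\<close>

lemma integer_vectors_Gordan:
  fixes v :: "'i \<Rightarrow> 'a::euclidean_space"
  assumes I: "finite I" and int: "\<And>i b. i \<in> I \<Longrightarrow> b \<in> Basis \<Longrightarrow> v i \<bullet> b \<in> \<int>"
  shows "(\<exists>w. \<forall>i\<in>I. w \<bullet> v i > 0) \<longleftrightarrow>
    (\<forall>n :: 'i \<Rightarrow> nat. (\<Sum>i\<in>I. real (n i) *\<^sub>R v i) = 0 \<longrightarrow> (\<forall>i\<in>I. n i = 0))"
    (is "?pos \<longleftrightarrow> ?indep")
proof
  assume ?pos
  then obtain w where w: "\<And>i. i \<in> I \<Longrightarrow> w \<bullet> v i > 0" by blast
  show ?indep
  proof (intro allI impI)
    fix n :: "'i \<Rightarrow> nat"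
    assume "(\<Sum>i\<in>I. real (n i) *\<^sub>R v i) = 0"
    \<comment> \<open>Pairing the relation with \<open>w\<close> leaves a vanishing sum of
      nonnegative terms, in which every factor \<open>w \<bullet> v i\<close> is positive.\<close>
    then have "(\<Sum>i\<in>I. real (n i) * (w \<bullet> v i)) = 0"
      by (metis (no_types, lifting) inner_scaleR_right inner_sum_right inner_zero_right sum.cong)
    then have "\<forall>i\<in>I. real (n i) * (w \<bullet> v i) = 0"
      using I w by (subst (asm) sum_nonneg_eq_0_iff) (simp_all add: less_imp_le)
    then show "\<forall>i\<in>I. n i = 0" using w by fastforce
  qed
next
  assume indep: ?indep
  define comb where "comb n = (\<Sum>i\<in>I. real (n i) *\<^sub>R v i)" for n :: "'i \<Rightarrow> nat"
  define M where "M = comb ` {n. \<exists>i\<in>I. n i \<noteq> 0}"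
  have comb_in_M: "comb n \<in> M" if "i \<in> I" "n i \<noteq> 0" for n i
    unfolding M_def using that by (intro imageI) blast
  have "\<exists>w. \<forall>x\<in>v ` I. w \<bullet> x > 0"
  \<comment> \<open>All coordinates are still to be eliminated, so the vanishing condition outside
    \<open>K\<close> is vacuous.\<close>
  proof (rule semigroup_integer_vectors_separation[where K = Basis])
    show "x + y \<in> M" if "x \<in> M" "y \<in> M" for x y
    proof -
      obtain m i where m: "x = comb m" "i \<in> I" "m i \<noteq> 0"
        using \<open>x \<in> M\<close> unfolding M_def by (elim imageE) blast
      obtain n where "y = comb n"
        using \<open>y \<in> M\<close> unfolding M_def by (elim imageE)
      with m have "x + y = comb (\<lambda>i. m i + n i)"
        by (simp add: comb_def scaleR_add_left sum.distrib)
      \<comment> \<open>Natural coefficients cannot cancel: \<open>m i \<noteq> 0\<close> forces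
        \<open>m i + n i \<noteq> 0\<close>.\<close>
      then show ?thesis using m comb_in_M[of i] by simp
    qed
    show "0 \<notin> M"
    proof
      assume "0 \<in> M"
      then obtain n where "comb n = 0" "\<exists>i\<in>I. n i \<noteq> 0"
        unfolding M_def by (elim imageE) simp
      with indep show False unfolding comb_def by simp
    qed
    show "v ` I \<subseteq> M"
    proof
      fix x assume "x \<in> v ` I"
      then obtain j where j: "j \<in> I" "x = v j" by blast
      have "comb (\<lambda>i. if i = j then 1 else 0) = (\<Sum>i\<in>I. if i = j then v i else 0)"
        unfolding comb_def by (rule sum.cong) auto
      also have "\<dots> = v j"
        using I j by simp
      finally show "x \<in> M"
        using j comb_in_M[of j "\<lambda>i. if i = j then 1 else 0"] by simp
    qed
  qed (use I int in auto)
  then show ?pos by blast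
qed

text \<open>The basis vectors are the \<open>axis e 1\<close>, so each coordinate is a sum of terms
  0, 1 and -1.\<close>

lemma cycle_vec_inner_Basis_Ints:
  assumes "b \<in> Basis"
  shows "cycle_vec D \<bullet> b \<in> \<int>"
  using assms
  by (auto simp: cycle_vec_def cycle_sign_def inner_sum_left Basis_vec_def inner_axis_axis
      intro!: Ints_sum)

lemma geometric_iff_positive:
  fixes G :: "('v, 'e::finite) pre_digraph"
  assumes "cycle_orientation_configuration G \<sigma>"
  shows "geometric G \<sigma> \<longleftrightarrow> (\<exists>w. \<forall>C\<in>cycles G. w \<bullet> cycle_vec (\<sigma> C) > 0)"
proof
  assume "\<exists>w. \<forall>C\<in>cycles G. w \<bullet> cycle_vec (\<sigma> C) > 0"
  then obtain w where w: "\<And>C. C \<in> cycles G \<Longrightarrow> w \<bullet> cycle_vec (\<sigma> C) > 0" by blast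
  obtain y z where y: "y \<in> H1 G" and z: "\<And>x. x \<in> H1 G \<Longrightarrow> orthogonal z x" and "w = y + z"
    unfolding H1_def
    by (rule orthogonal_subspace_decomp_exists[of "{cycle_vec D | D. oriented_cycle G D}" w]) (blast intro: that)
  have "y \<bullet> cycle_vec (\<sigma> C) > 0" if "C \<in> cycles G" for C
  proof -
    have "cycle_vec (\<sigma> C) \<in> H1 G"
      using assms that unfolding cycle_orientation_configuration_def H1_def
      by (blast intro: span_base)
    then have "z \<bullet> cycle_vec (\<sigma> C) = 0" using z by (simp add: orthogonal_def)
    with w[OF that] show ?thesis by (simp add: \<open>w = y + z\<close> inner_add_left)
  qed
  with y show "geometric G \<sigma>" unfolding geometric_def by blast
qed (auto simp: geometric_def)

theorem theorem3p6:
  fixes G :: "('v, 'e::finite) pre_digraph"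
    and \<sigma> :: "'e set \<Rightarrow> ('e \<times> bool) set"
  assumes "fin_digraph G"
    and "loopfree_digraph G"
    and "Digraph_Component.connected G"
    and "cycle_orientation_configuration G \<sigma>"
  shows "geometric G \<sigma> \<longleftrightarrow>
    (\<forall>n :: 'e set \<Rightarrow> nat.
      (\<Sum>C\<in>cycles G. real (n C) *\<^sub>R cycle_vec (\<sigma> C)) = 0 \<longrightarrow>
      (\<forall>C\<in>cycles G. n C = 0))"
  unfolding geometric_iff_positive[OF assms(4)]
  \<comment> \<open>The index set \<open>cycles G\<close> is finite because it consists of subsets
    of the finite type \<open>'e\<close>.\<close>
  by (rule integer_vectors_Gordan) (simp_all add: cycle_vec_inner_Basis_Ints)

end
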